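(* Let $(X,W)$ be a Landau–Ginzburg pair and $\Omega$ a holomorphic volume form on $X$. For any holomorphic factorizations $a_1$ and $a_2$ of $W$, we have $$\mathrm{tr}^B_{a_2}(\alpha\beta)=(-1)^{\deg\alpha\,\deg\beta}\,\mathrm{tr}^B_{a_1}(\beta\alpha)$$ when $\alpha\in\mathrm{Hom}_{\mathrm{DF}_c(X,W)}(a_1,a_2)$ and $\beta\in\mathrm{Hom}_{\mathrm{DF}_c(X,W)}(a_2,a_1)$ have pure total $\mathbb Z_2$-degree.
   Context: Landau–Ginzburg pair: $X$ is a connected, paracompact, non-compact complex manifold of dimension $d\ge1$ which admits a Kähler metric and whose canonical bundle $\wedge^dT^*X$ is holomorphically trivial; $W:X\to\mathbb C$ is a non-constant holomorphic function. A holomorphic volume form is a nowhere-vanishing holomorphic section of $\wedge^dT^*X$. $\mathcal A_c(X,E)$ is the space of compactly supported smooth $(0,* )$-forms valued in $E$. A holomorphic factorization of $W$ is $a=(E,D)$ with $E=E^{\hat0}\oplus E^{\hat1}$ a $\mathbb Z_2$-graded holomorphic vector bundle on $X$ and $D$ an odd holomorphic section of $\mathrm{End}(E)$ with $D^2=W\,\mathrm{id}_E$. For $a_i=(E_i,D_i)$, $\mathrm{Hom}_{\mathrm{DF}_c(X,W)}(a_1,a_2)=\mathcal A_c(X,Hom(E_1,E_2))$, with total $\mathbb Z_2$-degree $\deg(\rho\otimes f)=\mathrm{rk}\rho+\sigma(f)$ ($\mathrm{rk}$ = form degree mod 2, $\sigma$ = bundle degree) and composition (written as juxtaposition) $(\rho\otimes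 f)(\eta\otimes g)=(-1)^{\sigma(f)\mathrm{rk}\eta}(\rho\wedge\eta)\otimes(f\circ g)$. The extended supertrace $\mathrm{str}:\mathcal A(X,\mathrm{End}(E))\to\mathcal A(X)$ is $\mathrm{str}(\rho\otimes s)=\rho\,\mathrm{str}(s)$ with $\mathrm{str}(s)$ the fiberwise supertrace. For $a=(E,D)$, $\mathrm{tr}^B_a:\mathcal A_c(X,\mathrm{End}(E))\to\mathbb C$ is $\mathrm{tr}^B_a(\alpha)=\int_X\Omega\wedge\mathrm{str}(\alpha)$. *)

theory Defs
  imports "HOL-Analysis.Analysis"
begin

section \<open>Complex vector spaces\<close>

class complex_vector = ab_group_add +
  fixes scaleC :: "complex \<Rightarrow> 'a \<Rightarrow> 'a"  (infixr \<open>*\<^sub>C\<close> 75)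
  assumes scaleC_add_right: "a *\<^sub>C (x + y) = a *\<^sub>C x + a *\<^sub>C y"
    and scaleC_add_left: "(a + b) *\<^sub>C x = a *\<^sub>C x + b *\<^sub>C x"
    and scaleC_scaleC: "a *\<^sub>C (b *\<^sub>C x) = (a * b) *\<^sub>C x"
    and scaleC_one: "1 *\<^sub>C x = x"

global_interpretation complex_vector: vector_space "scaleC :: complex \<Rightarrow> 'a \<Rightarrow> 'a::complex_vector"
  defines cdependent = complex_vector.dependent
    and cspan = complex_vector.span
    and crepresentation = complex_vector.representation
  by unfold_locales
    (simp_all add: scaleC_add_right scaleC_add_left scaleC_scaleC scaleC_one)

instantiation complex :: complex_vector
begin
definition scaleC_complex :: "complex \<Rightarrow> complex \<Rightarrow> complex" where
  "scaleC_complex = (*)"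
instance
  by standard (simp_all add: scaleC_complex_def algebra_simps)
end

definition linear_between :: "'v::complex_vector set \<Rightarrow> 'w::complex_vector set \<Rightarrow> ('v \<Rightarrow> 'w) \<Rightarrow> bool" where
  "linear_between V W f \<longleftrightarrow>
     f ` V \<subseteq> W \<and>
     (\<forall>u\<in>V. \<forall>v\<in>V. f (u + v) = f u + f v) \<and>
     (\<forall>a. \<forall>u\<in>V. f (a *\<^sub>C u) = a *\<^sub>C f u)"

text \<open>Trace of an endomorphism of a finite-dimensional subspace, computed in some basis.\<close>

definition ctrace :: "'v::complex_vector set \<Rightarrow> ('v \<Rightarrow> 'v) \<Rightarrow> complex" where
  "ctrace V f =
     (let B = (SOME B. \<not> cdependent B \<and> cspan B = V)
      in \<Sum>b\<in>B. crepresentation B (f b) b)"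


section \<open>Holomorphic and smooth functions on open subsets of coordinate space\<close>

definition holo_on :: "(complex^'d) set \<Rightarrow> (complex^'d \<Rightarrow> complex) \<Rightarrow> bool" where
  "holo_on S f \<longleftrightarrow>
     (\<forall>z\<in>S. \<exists>f'. (f has_derivative f') (at z) \<and> (\<forall>a v. f' (a *s v) = a * f' v))"

text \<open>Only used for open \<open>S\<close> in finite-dimensional spaces.\<close>

fun Ck_on :: "nat \<Rightarrow> 'a::real_normed_vector set \<Rightarrow> ('a \<Rightarrow> 'b::real_normed_vector) \<Rightarrow> bool" where
  "Ck_on 0 S f \<longleftrightarrow> continuous_on S f"
| "Ck_on (Suc k) S f \<longleftrightarrow>
     (\<forall>z\<in>S. f differentiable (at z)) \<and> (\<forall>v. Ck_on k S (\<lambda>z. frechet_derivative f (at z) v))"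

definition smooth_on :: "'a::real_normed_vector set \<Rightarrow> ('a \<Rightarrow> 'b::real_normed_vector) \<Rightarrow> bool" where
  "smooth_on S f \<longleftrightarrow> (\<forall>k. Ck_on k S f)"


section \<open>Complex manifolds\<close>

text \<open>The dimension is \<open>CARD('d)\<close>; it is at least 1 because types are nonempty.
  Charts are pairs of a domain and a coordinate map; the set of charts is an atlas, which need
  not be maximal.\<close>

type_synonym ('x, 'd) chart = "'x set \<times> ('x \<Rightarrow> complex^'d)"

record ('x, 'd) cmfd =
  cm_top :: "'x topology"
  cm_charts :: "('x, 'd) chart set"

abbreviation pts :: "('x, 'd::finite) cmfd \<Rightarrow> 'x set" where
  "pts M \<equiv> topspace (cm_top M)"

definition chart_inv :: "('x, 'd::finite) chart \<Rightarrow> complex^'d \<Rightarrow> 'x" where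
  "chart_inv c = inv_into (fst c) (snd c)"

definition complex_manifold :: "('x, 'd::finite) cmfd \<Rightarrow> bool" where
  "complex_manifold M \<longleftrightarrow>
     Hausdorff_space (cm_top M) \<and>
     \<Union> (fst ` cm_charts M) = pts M \<and>
     (\<forall>(U, \<phi>)\<in>cm_charts M. openin (cm_top M) U \<and> open (\<phi> ` U) \<and>
        homeomorphic_map (subtopology (cm_top M) U) (top_of_set (\<phi> ` U)) \<phi>) \<and>
     (\<forall>c\<in>cm_charts M. \<forall>c'\<in>cm_charts M. \<forall>k.
        holo_on (snd c ` (fst c \<inter> fst c')) (\<lambda>z. snd c' (chart_inv c z) $ k))"

definition paracompact_space :: "'x topology \<Rightarrow> bool" where
  "paracompact_space X \<longleftrightarrow>
     (\<forall>\<U>. (\<forall>U\<in>\<U>. openin X U) \<and> \<Union>\<U> = topspace X \<longrightarrow>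
        (\<exists>\<V>. (\<forall>V\<in>\<V>. openin X V \<and> (\<exists>U\<in>\<U>. V \<subseteq> U)) \<and> \<Union>\<V> = topspace X \<and>
             locally_finite_in X \<V>))"

definition holo_fun :: "('x, 'd::finite) cmfd \<Rightarrow> 'x set \<Rightarrow> ('x \<Rightarrow> complex) \<Rightarrow> bool" where
  "holo_fun M U f \<longleftrightarrow>
     (\<forall>c\<in>cm_charts M. holo_on (snd c ` (fst c \<inter> U)) (f \<circ> chart_inv c))"

definition smooth_fun :: "('x, 'd::finite) cmfd \<Rightarrow> 'x set \<Rightarrow> ('x \<Rightarrow> 'b::real_normed_vector) \<Rightarrow> bool" where
  "smooth_fun M U f \<longleftrightarrow>
     (\<forall>c\<in>cm_charts M. smooth_on (snd c ` (fst c \<inter> U)) (f \<circ> chart_inv c))"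

text \<open>A tangent vector at \<open>x\<close> is the family of its components in all charts around \<open>x\<close>, related
  by the Jacobians of the coordinate changes; it is set to 0 at all other index pairs. The tangent
  space is the real tangent space, with its complex structure given by scalar multiplication of the
  components.\<close>

type_synonym ('x, 'd) tvec = "('x, 'd) chart \<Rightarrow> complex^'d"

definition charts_at :: "('x, 'd::finite) cmfd \<Rightarrow> 'x \<Rightarrow> ('x, 'd) chart set" where
  "charts_at M x = {c \<in> cm_charts M. x \<in> fst c}"

definition jacobian :: "('x, 'd::finite) chart \<Rightarrow> ('x, 'd) chart \<Rightarrow> 'x \<Rightarrow> complex^'d \<Rightarrow> complex^'d" where
  "jacobian c c' x = frechet_derivative (snd c' \<circ> chart_inv c) (at (snd c x))"

definition tangent_space :: "('x, 'd::finite) cmfd \<Rightarrow> 'x \<Rightarrow> ('x, 'd) tvec set" where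
  "tangent_space M x =
     {v. (\<forall>c. c \<notin> charts_at M x \<longrightarrow> v c = 0) \<and>
         (\<forall>c\<in>charts_at M x. \<forall>c'\<in>charts_at M x. v c' = jacobian c c' x (v c))}"

definition tadd :: "('x, 'd::finite) tvec \<Rightarrow> ('x, 'd) tvec \<Rightarrow> ('x, 'd) tvec" where
  "tadd v w = (\<lambda>c. v c + w c)"

definition tscale :: "complex \<Rightarrow> ('x, 'd::finite) tvec \<Rightarrow> ('x, 'd) tvec" where
  "tscale a v = (\<lambda>c. a *s v c)"

text \<open>The tangent vector at \<open>x\<close> whose component in the chart \<open>c\<close> is \<open>w\<close>.\<close>

definition coord_vec :: "('x, 'd::finite) cmfd \<Rightarrow> ('x, 'd) chart \<Rightarrow> 'x \<Rightarrow> complex^'d \<Rightarrow> ('x, 'd) tvec" where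
  "coord_vec M c x w = (\<lambda>c'. if c' \<in> charts_at M x then jacobian c c' x w else 0)"


section \<open>Differential forms\<close>

text \<open>An inhomogeneous form at a point is a function on lists of tangent vectors; its restriction to
  lists of length \<open>k\<close> is its component of degree \<open>k\<close>. Only the values on lists of vectors of the
  tangent space matter. With \<open>\<tau> = cnj\<close> the following are the forms of type \<open>(0,*)\<close>, with
  \<open>\<tau> = id\<close> those of type \<open>(*,0)\<close>: the complex-valued real-multilinear alternating forms that are
  conjugate-linear, respectively complex-linear, in every argument.\<close>

definition alt_form :: "(complex \<Rightarrow> complex) \<Rightarrow> ('x, 'd::finite) tvec set
    \<Rightarrow> (('x, 'd) tvec list \<Rightarrow> 'w::complex_vector) \<Rightarrow> bool" where
  "alt_form \<tau> T \<omega> \<longleftrightarrow>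
     (\<forall>us\<in>lists T. \<forall>ws\<in>lists T. \<forall>v\<in>T. \<forall>w\<in>T.
        \<omega> (us @ tadd v w # ws) = \<omega> (us @ v # ws) + \<omega> (us @ w # ws)) \<and>
     (\<forall>us\<in>lists T. \<forall>ws\<in>lists T. \<forall>v\<in>T. \<forall>a.
        \<omega> (us @ tscale a v # ws) = \<tau> a *\<^sub>C \<omega> (us @ v # ws)) \<and>
     (\<forall>vs\<in>lists T. \<not> distinct vs \<longrightarrow> \<omega> vs = 0)"

type_synonym ('x, 'd) cform = "'x \<Rightarrow> ('x, 'd) tvec list \<Rightarrow> complex"

text \<open>For \<open>A \<subseteq> {..<n}\<close>, the sign of the shuffle that lists \<open>A\<close> increasingly, followed by its
  complement.\<close>

definition shuffle_sign :: "nat \<Rightarrow> nat set \<Rightarrow> complex" where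
  "shuffle_sign n A = (-1) ^ card {(i, j). i < j \<and> j < n \<and> i \<notin> A \<and> j \<in> A}"

text \<open>Sums over all shuffles, so that \<open>dx \<and> dy\<close> takes the value 1 on the coordinate vectors.\<close>

definition wedge :: "('x, 'd::finite) cform \<Rightarrow> ('x, 'd) cform \<Rightarrow> ('x, 'd) cform" where
  "wedge \<omega> \<eta> = (\<lambda>x vs. \<Sum>A\<in>Pow {..<length vs}.
     shuffle_sign (length vs) A * (\<omega> x (nths vs A) * \<eta> x (nths vs ({..<length vs} - A))))"

definition holomorphic_form :: "('x, 'd::finite) cmfd \<Rightarrow> nat \<Rightarrow> ('x, 'd) cform \<Rightarrow> bool" where
  "holomorphic_form M p \<omega> \<longleftrightarrow>
     (\<forall>x\<in>pts M. alt_form id (tangent_space M x) (\<omega> x) \<and>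
        (\<forall>vs\<in>lists (tangent_space M x). length vs \<noteq> p \<longrightarrow> \<omega> x vs = 0)) \<and>
     (\<forall>c\<in>cm_charts M. \<forall>ws. holo_fun M (fst c) (\<lambda>x. \<omega> x (map (coord_vec M c x) ws)))"

definition holomorphic_volume_form :: "('x, 'd::finite) cmfd \<Rightarrow> ('x, 'd) cform \<Rightarrow> bool" where
  "holomorphic_volume_form M \<Omega> \<longleftrightarrow>
     holomorphic_form M CARD('d) \<Omega> \<and>
     (\<forall>x\<in>pts M. \<exists>vs\<in>lists (tangent_space M x). \<Omega> x vs \<noteq> 0)"

text \<open>A holomorphic trivialization of the canonical bundle \<open>K\<close>, given by the image \<open>\<Theta>\<close> of the
  constant section 1: the map \<open>(x, a) \<mapsto> a \<Theta> x\<close> is bijective onto each fibre of \<open>K\<close>.\<close>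

definition canonical_bundle_trivial :: "('x, 'd::finite) cmfd \<Rightarrow> bool" where
  "canonical_bundle_trivial M \<longleftrightarrow>
     (\<exists>\<Theta>. holomorphic_form M CARD('d) \<Theta> \<and>
        (\<forall>x\<in>pts M. \<forall>\<eta>. alt_form id (tangent_space M x) \<eta> \<and>
             (\<forall>vs\<in>lists (tangent_space M x). length vs \<noteq> CARD('d) \<longrightarrow> \<eta> vs = 0) \<longrightarrow>
           (\<exists>!a. \<forall>vs\<in>lists (tangent_space M x). \<eta> vs = a * \<Theta> x vs)))"


section \<open>Kaehler metrics\<close>

definition hermitian_metric :: "('x, 'd::finite) cmfd
    \<Rightarrow> ('x \<Rightarrow> ('x, 'd) tvec \<Rightarrow> ('x, 'd) tvec \<Rightarrow> complex) \<Rightarrow> bool" where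
  "hermitian_metric M h \<longleftrightarrow>
     (\<forall>x\<in>pts M. \<forall>u\<in>tangent_space M x. \<forall>v\<in>tangent_space M x. \<forall>w\<in>tangent_space M x. \<forall>a.
        h x (tadd u v) w = h x u w + h x v w \<and>
        h x (tscale a u) w = a * h x u w \<and>
        h x w u = cnj (h x u w) \<and>
        (u \<noteq> (\<lambda>_. 0) \<longrightarrow> Re (h x u u) > 0)) \<and>
     (\<forall>c\<in>cm_charts M. \<forall>v w. smooth_fun M (fst c) (\<lambda>x. h x (coord_vec M c x v) (coord_vec M c x w)))"

text \<open>The fundamental 2-form \<open>- Im h\<close> in the chart \<open>c\<close>, on constant coordinate vector fields.\<close>

definition fundamental_form_in :: "('x, 'd::finite) cmfd
    \<Rightarrow> ('x \<Rightarrow> ('x, 'd) tvec \<Rightarrow> ('x, 'd) tvec \<Rightarrow> complex) \<Rightarrow> ('x, 'd) chart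
    \<Rightarrow> complex^'d \<Rightarrow> complex^'d \<Rightarrow> complex^'d \<Rightarrow> real" where
  "fundamental_form_in M h c v w z =
     - Im (h (chart_inv c z) (coord_vec M c (chart_inv c z) v) (coord_vec M c (chart_inv c z) w))"

text \<open>Closedness of the fundamental form: the exterior derivative of a 2-form on constant vector
  fields is the cyclic sum of directional derivatives.\<close>

definition kaehler_metric :: "('x, 'd::finite) cmfd
    \<Rightarrow> ('x \<Rightarrow> ('x, 'd) tvec \<Rightarrow> ('x, 'd) tvec \<Rightarrow> complex) \<Rightarrow> bool" where
  "kaehler_metric M h \<longleftrightarrow>
     hermitian_metric M h \<and>
     (\<forall>c\<in>cm_charts M. \<forall>z\<in>snd c ` fst c. \<forall>u v w.
        frechet_derivative (fundamental_form_in M h c v w) (at z) u +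
        frechet_derivative (fundamental_form_in M h c w u) (at z) v +
        frechet_derivative (fundamental_form_in M h c u v) (at z) w = 0)"


section \<open>Landau-Ginzburg pairs\<close>

definition landau_ginzburg_pair :: "('x, 'd::finite) cmfd \<Rightarrow> ('x \<Rightarrow> complex) \<Rightarrow> bool" where
  "landau_ginzburg_pair M W \<longleftrightarrow>
     complex_manifold M \<and>
     connected_space (cm_top M) \<and>
     paracompact_space (cm_top M) \<and>
     \<not> compact_space (cm_top M) \<and>
     (\<exists>h. kaehler_metric M h) \<and>
     canonical_bundle_trivial M \<and>
     holo_fun M (pts M) W \<and>
     \<not> W constant_on (pts M)"


section \<open>Integration of forms\<close>

definition partition_of_unity :: "('x, 'd::finite) cmfd \<Rightarrow> (('x, 'd) chart \<Rightarrow> 'x \<Rightarrow> real) \<Rightarrow> bool" where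
  "partition_of_unity M \<rho> \<longleftrightarrow>
     (\<forall>c\<in>cm_charts M. smooth_fun M (pts M) (\<rho> c) \<and> (\<forall>x\<in>pts M. 0 \<le> \<rho> c x) \<and>
        cm_top M closure_of {x \<in> pts M. \<rho> c x \<noteq> 0} \<subseteq> fst c) \<and>
     (\<forall>x\<in>pts M. \<exists>V. openin (cm_top M) V \<and> x \<in> V \<and>
        finite {c \<in> cm_charts M. \<exists>y\<in>V. \<rho> c y \<noteq> 0}) \<and>
     (\<forall>x\<in>pts M. (\<Sum>c\<in>{c \<in> cm_charts M. \<rho> c x \<noteq> 0}. \<rho> c x) = 1)"

text \<open>The positively oriented real basis \<open>e\<^sub>1, \<i> e\<^sub>1, e\<^sub>2, \<i> e\<^sub>2, \<dots>\<close> of coordinate space. The order of the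
  coordinates does not matter, since it only permutes pairs of vectors.\<close>

definition oriented_basis :: "(complex^'d::finite) list" where
  "oriented_basis =
     concat (map (\<lambda>k. [axis k 1, axis k \<i>]) (SOME ks. distinct ks \<and> set ks = UNIV))"

text \<open>The integral of (the top-degree component of) a compactly supported form over the manifold with
  its complex orientation, via some smooth partition of unity subordinate to the atlas. Only finitely
  many summands are nonzero for a compactly supported form.\<close>

definition form_integral :: "('x, 'd::finite) cmfd \<Rightarrow> ('x, 'd) cform \<Rightarrow> complex" where
  "form_integral M \<omega> =
     (let \<rho> = (SOME \<rho>. partition_of_unity M \<rho>) in
      \<Sum>\<^sub>\<infinity>c\<in>cm_charts M.
        (LINT z : snd c ` fst c | lborel.
           \<rho> c (chart_inv c z) *\<^sub>R
           \<omega> (chart_inv c z) (map (coord_vec M c (chart_inv c z)) oriented_basis)))"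


section \<open>Holomorphic vector bundles\<close>

text \<open>The fibres are subspaces of one (possibly infinite-dimensional) complex vector space, which may
  be, for instance, the direct sum of all the fibres; the total space is their disjoint union. The
  holomorphic structure is given by an atlas of local frames \<open>(U, e)\<close>, equivalently of local
  trivializations, with holomorphic transition functions.\<close>

record ('x, 'e) vbundle =
  vb_rank :: nat
  vb_fibre :: "'x \<Rightarrow> 'e set"
  vb_frames :: "('x set \<times> (nat \<Rightarrow> 'x \<Rightarrow> 'e)) set"

definition frame_coeff :: "nat \<Rightarrow> (nat \<Rightarrow> 'x \<Rightarrow> 'e::complex_vector) \<Rightarrow> 'x \<Rightarrow> 'e \<Rightarrow> nat \<Rightarrow> complex" where
  "frame_coeff r e x u i = crepresentation ((\<lambda>k. e k x) ` {..<r}) u (e i x)"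

definition holomorphic_vbundle :: "('x, 'd::finite) cmfd \<Rightarrow> ('x, 'e::complex_vector) vbundle \<Rightarrow> bool" where
  "holomorphic_vbundle M E \<longleftrightarrow>
     \<Union> (fst ` vb_frames E) = pts M \<and>
     (\<forall>(U, e)\<in>vb_frames E. openin (cm_top M) U \<and>
        (\<forall>x\<in>U. inj_on (\<lambda>k. e k x) {..<vb_rank E} \<and>
               \<not> cdependent ((\<lambda>k. e k x) ` {..<vb_rank E}) \<and>
               cspan ((\<lambda>k. e k x) ` {..<vb_rank E}) = vb_fibre E x)) \<and>
     (\<forall>(U, e)\<in>vb_frames E. \<forall>(V, f)\<in>vb_frames E. \<forall>i<vb_rank E. \<forall>j<vb_rank E.
        holo_fun M (U \<inter> V) (\<lambda>x. frame_coeff (vb_rank E) e x (f j x) i))"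

definition vb_sum :: "('x, 'e::complex_vector) vbundle \<Rightarrow> ('x, 'e) vbundle \<Rightarrow> ('x, 'e) vbundle" where
  "vb_sum E F = \<lparr>
     vb_rank = vb_rank E + vb_rank F,
     vb_fibre = (\<lambda>x. {u + v |u v. u \<in> vb_fibre E x \<and> v \<in> vb_fibre F x}),
     vb_frames = {(U \<inter> V, \<lambda>k. if k < vb_rank E then e k else f (k - vb_rank E)) |U e V f.
                    (U, e) \<in> vb_frames E \<and> (V, f) \<in> vb_frames F}\<rparr>"

text \<open>A graded bundle is the pair of its even and odd part.\<close>

type_synonym ('x, 'e) gbundle = "('x, 'e) vbundle \<times> ('x, 'e) vbundle"

definition gpart :: "('x, 'e) gbundle \<Rightarrow> nat \<Rightarrow> ('x, 'e) vbundle" where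
  "gpart E i = (if even i then fst E else snd E)"

definition total :: "('x, 'e::complex_vector) gbundle \<Rightarrow> ('x, 'e) vbundle" where
  "total E = vb_sum (fst E) (snd E)"

definition graded_holomorphic_bundle :: "('x, 'd::finite) cmfd \<Rightarrow> ('x, 'e::complex_vector) gbundle \<Rightarrow> bool" where
  "graded_holomorphic_bundle M E \<longleftrightarrow>
     holomorphic_vbundle M (fst E) \<and> holomorphic_vbundle M (snd E) \<and>
     (\<forall>x\<in>pts M. vb_fibre (fst E) x \<inter> vb_fibre (snd E) x = {0})"

text \<open>The projection of the fibre at \<open>x\<close> onto the part of degree \<open>i\<close> along the other part.\<close>

definition gproj :: "('x, 'e::complex_vector) gbundle \<Rightarrow> 'x \<Rightarrow> nat \<Rightarrow> 'e \<Rightarrow> 'e" where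
  "gproj E x i u =
     (THE v. v \<in> vb_fibre (gpart E i) x \<and> u - v \<in> vb_fibre (gpart E (Suc i)) x)"

text \<open>Linear maps between fibres are functions of which only the values on the fibre matter.
  Degrees are taken modulo 2.\<close>

definition hom_degree :: "('x, 'e::complex_vector) gbundle \<Rightarrow> ('x, 'f::complex_vector) gbundle
    \<Rightarrow> 'x \<Rightarrow> nat \<Rightarrow> ('e \<Rightarrow> 'f) \<Rightarrow> bool" where
  "hom_degree E F x s f \<longleftrightarrow>
     (\<forall>i. f ` vb_fibre (gpart E i) x \<subseteq> vb_fibre (gpart F (i + s)) x)"

definition hom_part :: "('x, 'e::complex_vector) gbundle \<Rightarrow> ('x, 'f::complex_vector) gbundle
    \<Rightarrow> 'x \<Rightarrow> nat \<Rightarrow> ('e \<Rightarrow> 'f) \<Rightarrow> 'e \<Rightarrow> 'f" where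
  "hom_part E F x s f u = (\<Sum>i<2. gproj F x (i + s) (f (gproj E x i u)))"

definition supertrace :: "('x, 'e::complex_vector) gbundle \<Rightarrow> 'x \<Rightarrow> ('e \<Rightarrow> 'e) \<Rightarrow> complex" where
  "supertrace E x f =
     ctrace (vb_fibre (fst E) x) (\<lambda>u. gproj E x 0 (f u)) -
     ctrace (vb_fibre (snd E) x) (\<lambda>u. gproj E x 1 (f u))"


section \<open>Holomorphic factorizations\<close>

type_synonym ('x, 'e) factorization = "('x, 'e) gbundle \<times> ('x \<Rightarrow> 'e \<Rightarrow> 'e)"

definition holomorphic_endomorphism :: "('x, 'd::finite) cmfd \<Rightarrow> ('x, 'e::complex_vector) vbundle
    \<Rightarrow> ('x \<Rightarrow> 'e \<Rightarrow> 'e) \<Rightarrow> bool" where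
  "holomorphic_endomorphism M E D \<longleftrightarrow>
     (\<forall>x\<in>pts M. linear_between (vb_fibre E x) (vb_fibre E x) (D x)) \<and>
     (\<forall>(U, e)\<in>vb_frames E. \<forall>i<vb_rank E. \<forall>j<vb_rank E.
        holo_fun M U (\<lambda>x. frame_coeff (vb_rank E) e x (D x (e j x)) i))"

definition holomorphic_factorization :: "('x, 'd::finite) cmfd \<Rightarrow> ('x \<Rightarrow> complex)
    \<Rightarrow> ('x, 'e::complex_vector) factorization \<Rightarrow> bool" where
  "holomorphic_factorization M W = (\<lambda>(E, D).
     graded_holomorphic_bundle M E \<and>
     holomorphic_endomorphism M (total E) D \<and>
     (\<forall>x\<in>pts M. hom_degree E E x 1 (D x) \<and>
        (\<forall>u\<in>vb_fibre (total E) x. D x (D x u) = W x *\<^sub>C u)))"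


section \<open>Bundle-valued forms and the trace functional\<close>

type_synonym ('x, 'd, 'e, 'f) hom_form = "'x \<Rightarrow> ('x, 'd) tvec list \<Rightarrow> 'e \<Rightarrow> 'f"

text \<open>Smooth sections of \<open>\<And>T\<^sup>*\<^sup>0\<^sup>,\<^sup>1 \<otimes> Hom(E, F)\<close>.\<close>

definition smooth_hom_form :: "('x, 'd::finite) cmfd \<Rightarrow> ('x, 'e::complex_vector) vbundle
    \<Rightarrow> ('x, 'f::complex_vector) vbundle \<Rightarrow> ('x, 'd, 'e, 'f) hom_form \<Rightarrow> bool" where
  "smooth_hom_form M E F \<alpha> \<longleftrightarrow>
     (\<forall>x\<in>pts M.
        (\<forall>vs\<in>lists (tangent_space M x). linear_between (vb_fibre E x) (vb_fibre F x) (\<alpha> x vs)) \<and>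
        (\<forall>u\<in>vb_fibre E x. alt_form cnj (tangent_space M x) (\<lambda>vs. \<alpha> x vs u))) \<and>
     (\<forall>c\<in>cm_charts M. \<forall>(U, e)\<in>vb_frames E. \<forall>(V, f)\<in>vb_frames F.
        \<forall>ws. \<forall>j<vb_rank E. \<forall>i<vb_rank F.
        smooth_fun M (fst c \<inter> U \<inter> V)
          (\<lambda>x. frame_coeff (vb_rank F) f x (\<alpha> x (map (coord_vec M c x) ws) (e j x)) i))"

definition hom_form_support :: "('x, 'd::finite) cmfd \<Rightarrow> ('x, 'e::complex_vector) vbundle
    \<Rightarrow> ('x, 'd, 'e, 'f::complex_vector) hom_form \<Rightarrow> 'x set" where
  "hom_form_support M E \<alpha> =
     cm_top M closure_of
       {x \<in> pts M. \<exists>vs\<in>lists (tangent_space M x). \<exists>u\<in>vb_fibre E x. \<alpha> x vs u \<noteq> 0}"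

definition Hom_DFc :: "('x, 'd::finite) cmfd \<Rightarrow> ('x, 'e::complex_vector) factorization
    \<Rightarrow> ('x, 'f::complex_vector) factorization \<Rightarrow> ('x, 'd, 'e, 'f) hom_form set" where
  "Hom_DFc M a b =
     {\<alpha>. smooth_hom_form M (total (fst a)) (total (fst b)) \<alpha> \<and>
         compactin (cm_top M) (hom_form_support M (total (fst a)) \<alpha>)}"

text \<open>The component of form degree \<open>k\<close> of a form of total degree \<open>m\<close> has bundle degree
  \<open>m - k\<close>, that is \<open>m + k\<close> modulo 2.\<close>

definition has_total_degree :: "('x, 'd::finite) cmfd \<Rightarrow> ('x, 'e::complex_vector) factorization
    \<Rightarrow> ('x, 'f::complex_vector) factorization \<Rightarrow> ('x, 'd, 'e, 'f) hom_form \<Rightarrow> nat \<Rightarrow> bool" where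
  "has_total_degree M a b \<alpha> m \<longleftrightarrow>
     (\<forall>x\<in>pts M. \<forall>vs\<in>lists (tangent_space M x).
        hom_degree (fst a) (fst b) x (m + length vs) (\<alpha> x vs))"

text \<open>The composition \<open>\<alpha>\<beta>\<close> for \<open>\<alpha>\<close> in \<open>Hom(a, b)\<close>: the bilinear extension of
  \<open>(\<rho> \<otimes> f)(\<eta> \<otimes> g) = (-1)\<^bsup>\<sigma>(f) rk \<eta>\<^esup> (\<rho> \<and> \<eta>) \<otimes> (f \<circ> g)\<close>. The index \<open>s\<close> plays the role
  of \<open>\<sigma>(f)\<close>, and the number of arguments passed to \<open>\<beta>\<close> that of \<open>rk \<eta>\<close>.\<close>

definition df_comp :: "('x, 'e::complex_vector) factorization \<Rightarrow> ('x, 'f::complex_vector) factorization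
    \<Rightarrow> ('x, 'd::finite, 'e, 'f) hom_form \<Rightarrow> ('x, 'd, 'g::complex_vector, 'e) hom_form
    \<Rightarrow> ('x, 'd, 'g, 'f) hom_form" where
  "df_comp a b \<alpha> \<beta> = (\<lambda>x vs u. \<Sum>A\<in>Pow {..<length vs}. \<Sum>s<2.
     (shuffle_sign (length vs) A * (-1) ^ (s * card ({..<length vs} - A))) *\<^sub>C
     hom_part (fst a) (fst b) x s (\<alpha> x (nths vs A)) (\<beta> x (nths vs ({..<length vs} - A)) u))"

definition ext_supertrace :: "('x, 'e::complex_vector) gbundle \<Rightarrow> ('x, 'd::finite, 'e, 'e) hom_form
    \<Rightarrow> ('x, 'd) cform" where
  "ext_supertrace E \<alpha> = (\<lambda>x vs. supertrace E x (\<alpha> x vs))"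

definition trB :: "('x, 'd::finite) cmfd \<Rightarrow> ('x, 'd) cform \<Rightarrow> ('x, 'e::complex_vector) factorization
    \<Rightarrow> ('x, 'd, 'e, 'e) hom_form \<Rightarrow> complex" where
  "trB M \<Omega> a \<alpha> = form_integral M (wedge \<Omega> (ext_supertrace (fst a) \<alpha>))"

end

theory Submission
  imports Defs
begin

text \<open>The identity is pointwise: the extended supertraces of \<open>\<alpha>\<beta>\<close> and \<open>\<beta>\<alpha>\<close> already agree up to
  the sign \<open>(-1)\<^bsup>mn\<^esup>\<close> at every point and on every list of tangent vectors
  (\<open>supertrace_df_comp_commute\<close>), so their wedge products with \<open>\<Omega>\<close> do too, and the integral is
  linear.

  On tangent vectors \<open>vs\<close> the composition \<open>\<alpha>\<beta>\<close> is a signed sum over the subsets \<open>A\<close> of the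
  positions: \<open>\<alpha>\<close> takes the \<open>k\<close> arguments in \<open>A\<close>, \<open>\<beta>\<close> the remaining \<open>l\<close>. As \<open>\<alpha>\<close> has total
  degree \<open>m\<close> and \<open>\<beta>\<close> has total degree \<open>n\<close>, the two resulting linear maps have bundle degrees
  \<open>m + k\<close> and \<open>n + l\<close>. If \<open>m + n + k + l\<close> is odd, both compositions exchange the even and odd
  parts of the fibre, and both supertraces vanish. Otherwise the summand of \<open>\<alpha>\<beta>\<close> at \<open>A\<close> is compared
  with the summand of \<open>\<beta>\<alpha>\<close> at the complement of \<open>A\<close>. Three signs enter: the Koszul signs
  \<open>(-1)\<^bsup>(m+k)l\<^esup>\<close> and \<open>(-1)\<^bsup>(n+l)k\<^esup>\<close> of the two compositions, the sign \<open>(-1)\<^bsup>kl\<^esup>\<close> of interchanging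
  the two blocks of arguments (\<open>shuffle_sign_complement\<close>), and the sign \<open>(-1)\<^bsup>(m+k)(n+l)\<^esup>\<close> from the
  cyclicity of the supertrace of homogeneous maps (\<open>graded_trace_commute\<close>). Their product is
  \<open>(-1)\<^bsup>mn\<^esup>\<close>, whatever \<open>A\<close> is.

  To pass from this fibrewise identity to the integral, the arguments at which the integrand is
  evaluated must be tangent vectors. For the coordinate vectors this is the chain rule for the
  Jacobians of the coordinate changes (\<open>jacobian_chain\<close>).\<close>

section \<open>Traces on finite-dimensional subspaces\<close>

definition finite_dimensional :: "'v::complex_vector set \<Rightarrow> bool" where
  "finite_dimensional V \<longleftrightarrow> (\<exists>S. finite S \<and> cspan S = V)"

lemma finite_dimensional_subspace: "finite_dimensional V \<Longrightarrow> complex_vector.subspace V"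
  unfolding finite_dimensional_def using complex_vector.subspace_span by blast

text \<open>The trace is defined by a chosen basis, which a priori could be infinite; it is finite because
  the subspace has a finite spanning set. One basis serves for all endomorphisms \<open>f\<close> at once,
  which is what linearity and commutativity of the trace rest on.\<close>

lemma ctrace_in_basis:
  assumes "finite_dimensional V"
  obtains B where "finite B" "B \<subseteq> V" "\<not> cdependent B" "cspan B = V"
    "\<And>f. ctrace V f = (\<Sum>b\<in>B. crepresentation B (f b) b)"
proof -
  obtain S where S: "finite S" "cspan S = V"
    using assms by (auto simp: finite_dimensional_def)
  let ?P = "\<lambda>B. \<not> cdependent B \<and> cspan B = V"
  define B where "B = (SOME B. ?P B)"
  obtain B' where B': "B' \<subseteq> V" "\<not> cdependent B'" "V \<subseteq> cspan B'"
    using complex_vector.maximal_independent_subset by blast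
  have "cspan B' = V"
    using B' S complex_vector.span_minimal[OF B'(1)] complex_vector.subspace_span by blast
  then have "\<exists>B. ?P B" using B' by blast
  then have P: "?P B" unfolding B_def by (rule someI_ex)
  then have sub: "B \<subseteq> V" using complex_vector.span_superset by blast
  then have "finite B"
    using complex_vector.independent_span_bound[of S B] S P by auto
  then show ?thesis
    using that[of B] P sub by (auto simp: ctrace_def B_def Let_def)
qed

lemma ctrace_cong:
  assumes "finite_dimensional V" "\<And>u. u \<in> V \<Longrightarrow> f u = g u"
  shows "ctrace V f = ctrace V g"
proof -
  obtain B where B: "finite B" "B \<subseteq> V" "\<not> cdependent B" "cspan B = V"
    "\<And>f. ctrace V f = (\<Sum>b\<in>B. crepresentation B (f b) b)"
    using ctrace_in_basis[OF assms(1)] by metis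
  have "(\<Sum>b\<in>B. crepresentation B (f b) b) = (\<Sum>b\<in>B. crepresentation B (g b) b)"
    using assms(2) B(2) by (intro sum.cong) auto
  then show ?thesis by (simp add: B(5))
qed

lemma ctrace_sum:
  assumes V: "finite_dimensional V"
    and f: "\<And>i u. i \<in> I \<Longrightarrow> u \<in> V \<Longrightarrow> f i u \<in> V"
  shows "ctrace V (\<lambda>u. \<Sum>i\<in>I. a i *\<^sub>C f i u) = (\<Sum>i\<in>I. a i * ctrace V (f i))"
proof -
  obtain B where B: "finite B" "B \<subseteq> V" "\<not> cdependent B" "cspan B = V"
    "\<And>f. ctrace V f = (\<Sum>b\<in>B. crepresentation B (f b) b)"
    using ctrace_in_basis[OF V] by metis
  have "crepresentation B (\<Sum>i\<in>I. a i *\<^sub>C f i b) b = (\<Sum>i\<in>I. a i * crepresentation B (f i b) b)"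
    if "b \<in> B" for b
  proof -
    have "f i b \<in> cspan B" if "i \<in> I" for i using f that \<open>b \<in> B\<close> B by blast
    then show ?thesis
      using B(3)
      by (simp add: complex_vector.representation_sum complex_vector.representation_scale
          complex_vector.span_scale)
  qed
  then have "ctrace V (\<lambda>u. \<Sum>i\<in>I. a i *\<^sub>C f i u) = (\<Sum>b\<in>B. \<Sum>i\<in>I. a i * crepresentation B (f i b) b)"
    by (simp add: B(5))
  also have "\<dots> = (\<Sum>i\<in>I. a i * ctrace V (f i))"
    unfolding B(5) sum_distrib_left by (rule sum.swap)
  finally show ?thesis .
qed

lemma ctrace_zero:
  assumes "finite_dimensional V" shows "ctrace V (\<lambda>_. 0) = 0"
  using ctrace_sum[OF assms, of "{}"] by simp

lemma linear_between_zero: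
  assumes "linear_between V W f" "complex_vector.subspace V"
  shows "f 0 = 0"
proof -
  have "0 \<in> V" using assms(2) by (rule complex_vector.subspace_0)
  then have "f (0 *\<^sub>C 0) = 0 *\<^sub>C f 0" using assms(1) unfolding linear_between_def by blast
  then show ?thesis by simp
qed

lemma linear_between_sum:
  assumes f: "linear_between V W f" and V: "complex_vector.subspace V"
    and I: "\<And>i. i \<in> I \<Longrightarrow> v i \<in> V"
  shows "f (\<Sum>i\<in>I. a i *\<^sub>C v i) = (\<Sum>i\<in>I. a i *\<^sub>C f (v i))"
  using I
proof (induction I rule: infinite_finite_induct)
  case (insert i I)
  have V': "(\<Sum>i\<in>I. a i *\<^sub>C v i) \<in> V" "a i *\<^sub>C v i \<in> V" "v i \<in> V"
    using insert.prems
    by (auto intro!: complex_vector.subspace_sum[OF V] complex_vector.subspace_scale[OF V])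
  have "f (a i *\<^sub>C v i + (\<Sum>i\<in>I. a i *\<^sub>C v i)) = a i *\<^sub>C f (v i) + f (\<Sum>i\<in>I. a i *\<^sub>C v i)"
    using f V' by (simp add: linear_between_def)
  then show ?case using insert by simp
qed (simp_all add: linear_between_zero[OF f V])

text \<open>With bases \<open>B\<close> of \<open>V\<close> and \<open>C\<close> of \<open>W\<close>, both traces are the same double sum over \<open>B \<times> C\<close> of
  products of matrix entries. The two spaces may live in different ambient types, as the fibres
  of two different bundles do.\<close>

lemma ctrace_commute:
  assumes V: "finite_dimensional V" and W: "finite_dimensional W"
    and f: "linear_between W V f" and g: "linear_between V W g"
  shows "ctrace V (\<lambda>u. f (g u)) = ctrace W (\<lambda>u. g (f u))"
proof -
  \<comment> \<open>Stated for arbitrary spaces, so that it serves for both orders of composition.\<close>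
  have expand: "ctrace V (\<lambda>u. f (g u)) =
      (\<Sum>b\<in>B. \<Sum>c\<in>C. crepresentation C (g b) c * crepresentation B (f c) b)"
    if V: "finite_dimensional V" and W: "finite_dimensional W"
      and f: "linear_between W V f" and g: "linear_between V W g"
      and B: "finite B" "B \<subseteq> V" "\<not> cdependent B" "cspan B = V"
        "\<And>f. ctrace V f = (\<Sum>b\<in>B. crepresentation B (f b) b)"
      and C: "finite C" "C \<subseteq> W" "\<not> cdependent C" "cspan C = W"
    for V :: "'x::complex_vector set" and W :: "'y::complex_vector set" and f g B C
  proof -
    have "crepresentation B (f (g b)) b =
        (\<Sum>c\<in>C. crepresentation C (g b) c * crepresentation B (f c) b)" if "b \<in> B" for b
    proof -
      have "g b \<in> cspan C" using that B(2) C(4) g by (auto simp: linear_between_def)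
      then have "g b = (\<Sum>c\<in>C. crepresentation C (g b) c *\<^sub>C c)"
        using complex_vector.sum_representation_eq[OF C(3) _ C(1)] by simp
      then have "f (g b) = f (\<Sum>c\<in>C. crepresentation C (g b) c *\<^sub>C c)" by simp
      also have "\<dots> = (\<Sum>c\<in>C. crepresentation C (g b) c *\<^sub>C f c)"
        using C(2) by (intro linear_between_sum[OF f finite_dimensional_subspace[OF W]]) auto
      finally have eq: "f (g b) = (\<Sum>c\<in>C. crepresentation C (g b) c *\<^sub>C f c)" .
      have "f c \<in> cspan B" if "c \<in> C" for c
        using that C(2) B(4) f by (auto simp: linear_between_def)
      then show ?thesis unfolding eq using B(3)
        by (simp add: complex_vector.representation_sum complex_vector.representation_scale
            complex_vector.span_scale)
    qed
    then show ?thesis by (simp add: B(5))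
  qed
  obtain B where B: "finite B" "B \<subseteq> V" "\<not> cdependent B" "cspan B = V"
    "\<And>f. ctrace V f = (\<Sum>b\<in>B. crepresentation B (f b) b)"
    using ctrace_in_basis[OF V] by metis
  obtain C where C: "finite C" "C \<subseteq> W" "\<not> cdependent C" "cspan C = W"
    "\<And>f. ctrace W f = (\<Sum>b\<in>C. crepresentation C (f b) b)"
    using ctrace_in_basis[OF W] by metis
  show ?thesis
    unfolding expand[OF V W f g B C(1-4)] expand[OF W V g f C B(1-4)]
    by (subst sum.swap) (simp add: mult.commute)
qed


section \<open>Homogeneous maps between graded fibres\<close>

lemma sum_over_parity: "(\<Sum>i<2. f i) = f 0 + f (1::nat)"
  by (simp add: numeral_2_eq_2)

lemma gpart_cong: "even (i + j) \<Longrightarrow> gpart E i = gpart E j"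
  by (auto simp: gpart_def)

lemma finite_dimensional_fibre:
  assumes "holomorphic_vbundle M E" "x \<in> pts M"
  shows "finite_dimensional (vb_fibre E x)"
proof -
  have "x \<in> \<Union> (fst ` vb_frames E)"
    using assms unfolding holomorphic_vbundle_def by blast
  then obtain U e where "(U, e) \<in> vb_frames E" "x \<in> U" by auto
  moreover have "\<forall>(U, e)\<in>vb_frames E. \<forall>x\<in>U. cspan ((\<lambda>k. e k x) ` {..<vb_rank E}) = vb_fibre E x"
    using assms(1) unfolding holomorphic_vbundle_def by blast
  ultimately have "cspan ((\<lambda>k. e k x) ` {..<vb_rank E}) = vb_fibre E x" by blast
  then show ?thesis by (auto simp: finite_dimensional_def)
qed

lemma finite_dimensional_gpart:
  assumes "graded_holomorphic_bundle M E" "x \<in> pts M"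
  shows "finite_dimensional (vb_fibre (gpart E i) x)"
  using assms finite_dimensional_fibre by (auto simp: graded_holomorphic_bundle_def gpart_def)

lemmas subspace_gpart = finite_dimensional_subspace[OF finite_dimensional_gpart]

lemma gpart_disjoint:
  assumes "graded_holomorphic_bundle M E" "x \<in> pts M"
    and "v \<in> vb_fibre (gpart E i) x" "v \<in> vb_fibre (gpart E (Suc i)) x"
  shows "v = 0"
  using assms by (auto simp: graded_holomorphic_bundle_def gpart_def split: if_splits)

lemma gpart_subset_total:
  assumes "graded_holomorphic_bundle M E" "x \<in> pts M"
  shows "vb_fibre (gpart E i) x \<subseteq> vb_fibre (total E) x"
proof
  fix u assume u: "u \<in> vb_fibre (gpart E i) x"
  have "0 \<in> vb_fibre (fst E) x" "0 \<in> vb_fibre (snd E) x"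
    using complex_vector.subspace_0[OF subspace_gpart[OF assms, of 0]]
      complex_vector.subspace_0[OF subspace_gpart[OF assms, of 1]]
    by (simp_all add: gpart_def)
  then show "u \<in> vb_fibre (total E) x"
    using u by (force simp: gpart_def total_def vb_sum_def split: if_splits)
qed

text \<open>The definite description in the projection has a unique solution because the two parts of the
  fibre intersect trivially.\<close>

lemma gproj_homogeneous:
  assumes E: "graded_holomorphic_bundle M E" "x \<in> pts M"
    and u: "u \<in> vb_fibre (gpart E j) x"
  shows "gproj E x i u = (if even (i + j) then u else 0)"
proof -
  note sub = subspace_gpart[OF E]
  let ?w = "if even (i + j) then u else 0"
  have w: "?w \<in> vb_fibre (gpart E i) x" "u - ?w \<in> vb_fibre (gpart E (Suc i)) x"
    using u gpart_cong[of i j E] gpart_cong[of "Suc i" j E] complex_vector.subspace_0[OF sub]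
    by auto
  show ?thesis
    unfolding gproj_def
  proof (rule the_equality)
    fix v assume v: "v \<in> vb_fibre (gpart E i) x \<and> u - v \<in> vb_fibre (gpart E (Suc i)) x"
    have "v - ?w \<in> vb_fibre (gpart E i) x"
      using complex_vector.subspace_diff[OF sub] v w by blast
    moreover have "(u - ?w) - (u - v) \<in> vb_fibre (gpart E (Suc i)) x"
      using complex_vector.subspace_diff[OF sub] v w by blast
    moreover have "(u - ?w) - (u - v) = v - ?w" by simp
    ultimately have "v - ?w = 0" using gpart_disjoint[OF E] by metis
    then show "v = ?w" by simp
  qed (use w in blast)
qed

lemma hom_degreeD:
  "hom_degree E F x s f \<Longrightarrow> u \<in> vb_fibre (gpart E i) x \<Longrightarrow> f u \<in> vb_fibre (gpart F (i + s)) x"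
  by (auto simp: hom_degree_def)

text \<open>On homogeneous vectors a homogeneous map is its own component of the matching parity. The value
  at 0 has to be controlled because the other projection of the argument is 0 and is still fed to
  \<open>f\<close>.\<close>

lemma hom_part_homogeneous:
  assumes E: "graded_holomorphic_bundle M E" and F: "graded_holomorphic_bundle M F"
    and x: "x \<in> pts M" and f: "hom_degree E F x d f" "f 0 = 0"
    and u: "u \<in> vb_fibre (gpart E i) x"
  shows "hom_part E F x s f u = (if even (s + d) then f u else 0)"
proof -
  have pE: "gproj E x t u = (if even (t + i) then u else 0)" for t
    using gproj_homogeneous[OF E x u] .
  have pF: "gproj F x t (f u) = (if even (t + (i + d)) then f u else 0)" for t
    using gproj_homogeneous[OF F x hom_degreeD[OF f(1) u]] .
  have p0: "gproj F x t 0 = 0" for t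
    using gproj_homogeneous[OF F x complex_vector.subspace_0[OF subspace_gpart[OF F x]]] by simp
  show ?thesis
    by (simp add: hom_part_def pE pF p0 f(2) sum_over_parity)
qed


section \<open>The fibrewise supertrace\<close>

text \<open>The supertrace without the projections to the two parts, which are redundant for an even
  endomorphism. Indexing the parts by the parity \<open>i\<close> turns a degree shift into a shift of the
  index.\<close>

definition graded_trace :: "('x, 'e::complex_vector) gbundle \<Rightarrow> 'x \<Rightarrow> ('e \<Rightarrow> 'e) \<Rightarrow> complex" where
  "graded_trace E x f = (\<Sum>i<2. (-1) ^ i * ctrace (vb_fibre (gpart E i) x) f)"

text \<open>An odd endomorphism has no diagonal blocks, so its supertrace vanishes.\<close>

lemma supertrace_homogeneous:
  assumes E: "graded_holomorphic_bundle M E" and x: "x \<in> pts M"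
    and f: "hom_degree E E x d f"
  shows "supertrace E x f = (if even d then graded_trace E x f else 0)"
proof -
  have "ctrace (vb_fibre (gpart E i) x) (\<lambda>u. gproj E x i (f u)) =
      (if even d then ctrace (vb_fibre (gpart E i) x) f else 0)" for i
  proof -
    have "gproj E x i (f u) = (if even d then f u else 0)" if "u \<in> vb_fibre (gpart E i) x" for u
      using gproj_homogeneous[OF E x hom_degreeD[OF f that], of i] by auto
    then have "ctrace (vb_fibre (gpart E i) x) (\<lambda>u. gproj E x i (f u)) =
        ctrace (vb_fibre (gpart E i) x) (\<lambda>u. if even d then f u else 0)"
      by (intro ctrace_cong finite_dimensional_gpart[OF E x]) auto
    then show ?thesis
      by (cases "even d") (simp_all add: ctrace_zero[OF finite_dimensional_gpart[OF E x]])
  qed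
  from this[of 0] this[of 1] show ?thesis
    by (simp add: supertrace_def graded_trace_def gpart_def sum_over_parity)
qed

lemma linear_between_gpart:
  assumes E: "graded_holomorphic_bundle M E" and x: "x \<in> pts M"
    and f: "linear_between (vb_fibre (total E) x) (vb_fibre (total F) x) f" "hom_degree E F x s f"
  shows "linear_between (vb_fibre (gpart E i) x) (vb_fibre (gpart F (i + s)) x) f"
  using f gpart_subset_total[OF E x, of i]
  unfolding linear_between_def hom_degree_def by blast

text \<open>The trace of \<open>fg\<close> on the part of degree \<open>i\<close> is the trace of \<open>gf\<close> on the part of degree \<open>i + t\<close>.
  For odd \<open>t\<close> this swaps the two parts and hence changes the sign; since \<open>s\<close> and \<open>t\<close> have equal
  parity, that sign is \<open>(-1)\<^bsup>st\<^esup>\<close>.\<close>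

lemma graded_trace_commute:
  assumes E: "graded_holomorphic_bundle M E" and F: "graded_holomorphic_bundle M F"
    and x: "x \<in> pts M"
    and f: "linear_between (vb_fibre (total E) x) (vb_fibre (total F) x) f" "hom_degree E F x s f"
    and g: "linear_between (vb_fibre (total F) x) (vb_fibre (total E) x) g" "hom_degree F E x t g"
    and st: "even (s + t)"
  shows "graded_trace F x (\<lambda>u. f (g u)) = (-1) ^ (s * t) * graded_trace E x (\<lambda>u. g (f u))"
proof -
  have tr: "ctrace (vb_fibre (gpart F i) x) (\<lambda>u. f (g u)) =
      ctrace (vb_fibre (gpart E (i + t)) x) (\<lambda>u. g (f u))" for i
  proof (rule ctrace_commute)
    have "gpart F (i + t + s) = gpart F i" using st by (intro gpart_cong) auto
    then show "linear_between (vb_fibre (gpart E (i + t)) x) (vb_fibre (gpart F i) x) f"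
      using linear_between_gpart[OF E x f, of "i + t"] by simp
    show "linear_between (vb_fibre (gpart F i) x) (vb_fibre (gpart E (i + t)) x) g"
      using linear_between_gpart[OF F x g] .
  qed (simp_all add: finite_dimensional_gpart[OF E x] finite_dimensional_gpart[OF F x])
  show ?thesis
    using st tr[of 0] tr[of 1]
    by (cases "even t") (auto simp: graded_trace_def gpart_def sum_over_parity)
qed

lemma graded_trace_sum:
  assumes E: "graded_holomorphic_bundle M E" and x: "x \<in> pts M"
    and f: "\<And>A. A \<in> I \<Longrightarrow> hom_degree E E x d (f A)" and d: "even d"
  shows "graded_trace E x (\<lambda>u. \<Sum>A\<in>I. a A *\<^sub>C f A u) = (\<Sum>A\<in>I. a A * graded_trace E x (f A))"
proof -
  have "f A u \<in> vb_fibre (gpart E i) x" if "A \<in> I" "u \<in> vb_fibre (gpart E i) x" for A u i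
    using hom_degreeD[OF f[OF that(1)] that(2)] gpart_cong[of "i + d" i E] d by simp
  then have "ctrace (vb_fibre (gpart E i) x) (\<lambda>u. \<Sum>A\<in>I. a A *\<^sub>C f A u) =
      (\<Sum>A\<in>I. a A * ctrace (vb_fibre (gpart E i) x) (f A))" for i
    by (intro ctrace_sum finite_dimensional_gpart[OF E x]) auto
  then show ?thesis
    by (simp add: graded_trace_def sum_over_parity sum_subtractf right_diff_distrib)
qed


section \<open>The supertrace of a composition\<close>

text \<open>The inversions of the shuffle for \<open>A\<close>, together with the reversed inversions of the shuffle for
  the complement, are exactly the pairs consisting of a position outside \<open>A\<close> and one inside.\<close>

lemma shuffle_sign_complement:
  assumes "A \<subseteq> {..<N}"
  shows "shuffle_sign N A * shuffle_sign N ({..<N} - A) = (-1) ^ (card A * card ({..<N} - A))"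
proof -
  let ?P = "{(i, j). i < j \<and> j < N \<and> i \<notin> A \<and> j \<in> A}"
  let ?Q = "{(i, j). i < j \<and> j < N \<and> i \<notin> {..<N} - A \<and> j \<in> {..<N} - A}"
  have "?P \<subseteq> {..<N} \<times> {..<N}" "?Q \<subseteq> {..<N} \<times> {..<N}" by auto
  then have fin: "finite ?P" "finite ?Q" using finite_subset by blast+
  have "?P \<union> prod.swap ` ?Q = ({..<N} - A) \<times> A"
  proof (intro set_eqI iffI)
    fix p assume "p \<in> ({..<N} - A) \<times> A"
    then obtain i j where p: "p = (i, j)" "i < N" "i \<notin> A" "j \<in> A" by auto
    then have "j < N" "i \<noteq> j" using assms by auto
    show "p \<in> ?P \<union> prod.swap ` ?Q"
    proof (cases "i < j")
      case False
      then have "(j, i) \<in> ?Q" using p \<open>i \<noteq> j\<close> by auto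
      then have "prod.swap (j, i) \<in> prod.swap ` ?Q" by (rule imageI)
      then show ?thesis using p by simp
    qed (use p \<open>j < N\<close> in auto)
  qed (use assms in auto)
  moreover have "?P \<inter> prod.swap ` ?Q = {}" by auto
  moreover have "card (prod.swap ` ?Q) = card ?Q" by (intro card_image) auto
  ultimately have "card ?P + card ?Q = card (({..<N} - A) \<times> A)"
    using fin card_Un_disjoint[of ?P "prod.swap ` ?Q"] by simp
  then show ?thesis
    unfolding shuffle_sign_def power_add[symmetric] by (simp add: card_cartesian_product mult.commute)
qed

lemma nths_in_lists: "vs \<in> lists T \<Longrightarrow> nths vs A \<in> lists T"
  using set_nths_subset by fastforce

lemma length_nths_subset: "A \<subseteq> {..<length vs} \<Longrightarrow> length (nths vs A) = card A"
  unfolding length_nths by (rule arg_cong[of _ _ card]) auto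

lemma smooth_hom_form_linear:
  assumes "\<alpha> \<in> Hom_DFc M a b" "x \<in> pts M" "vs \<in> lists (tangent_space M x)"
  shows "linear_between (vb_fibre (total (fst a)) x) (vb_fibre (total (fst b)) x) (\<alpha> x vs)"
  using assms by (auto simp: Hom_DFc_def smooth_hom_form_def)

lemma hom_form_degree:
  assumes "has_total_degree M a b \<alpha> m" "x \<in> pts M" "vs \<in> lists (tangent_space M x)"
    "A \<subseteq> {..<length vs}"
  shows "hom_degree (fst a) (fst b) x (m + card A) (\<alpha> x (nths vs A))"
proof -
  have "hom_degree (fst a) (fst b) x (m + length (nths vs A)) (\<alpha> x (nths vs A))"
    using assms(1,2) nths_in_lists[OF assms(3)] unfolding has_total_degree_def by blast
  then show ?thesis by (simp only: length_nths_subset[OF assms(4)])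
qed

text \<open>Applied to arguments indexed by \<open>A\<close>, the form \<open>\<alpha>\<close> is a map of bundle degree \<open>m + |A|\<close>, so only one
  of the two values of the summation index in the composition contributes, and it fixes the Koszul
  sign.\<close>

lemma df_comp_homogeneous:
  assumes a: "graded_holomorphic_bundle M (fst a)" and b: "graded_holomorphic_bundle M (fst b)"
    and \<alpha>: "\<alpha> \<in> Hom_DFc M a b" "has_total_degree M a b \<alpha> m"
    and \<beta>: "has_total_degree M b a \<beta> n"
    and x: "x \<in> pts M" and vs: "vs \<in> lists (tangent_space M x)"
    and u: "u \<in> vb_fibre (gpart (fst b) i) x"
  shows "df_comp a b \<alpha> \<beta> x vs u = (\<Sum>A\<in>Pow {..<length vs}.
     (shuffle_sign (length vs) A * (-1) ^ ((m + card A) * card ({..<length vs} - A))) *\<^sub>C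
     \<alpha> x (nths vs A) (\<beta> x (nths vs ({..<length vs} - A)) u))"
  unfolding df_comp_def
proof (rule sum.cong[OF refl])
  fix A assume "A \<in> Pow {..<length vs}"
  then have A: "A \<subseteq> {..<length vs}" by auto
  let ?f = "\<alpha> x (nths vs A)"
  let ?v = "\<beta> x (nths vs ({..<length vs} - A)) u"
  let ?l = "card ({..<length vs} - A)"
  \<comment> \<open>Linearity is only known on the total fibre, so that must be seen to be a subspace.\<close>
  have "?f 0 = 0"
  proof (rule linear_between_zero[OF smooth_hom_form_linear[OF \<alpha>(1) x nths_in_lists[OF vs]]])
    show "complex_vector.subspace (vb_fibre (total (fst a)) x)"
      using complex_vector.subspace_sums[OF subspace_gpart[OF a x, of 0] subspace_gpart[OF a x, of 1]]
      by (simp add: gpart_def total_def vb_sum_def)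
  qed
  moreover have "?v \<in> vb_fibre (gpart (fst a) (i + (n + ?l))) x"
    by (rule hom_degreeD[OF hom_form_degree[OF \<beta> x vs] u]) auto
  ultimately have part: "hom_part (fst a) (fst b) x s ?f ?v =
      (if even (s + (m + card A)) then ?f ?v else 0)" for s
    using hom_part_homogeneous[OF a b x hom_form_degree[OF \<alpha>(2) x vs A]] by blast
  show "(\<Sum>s<2. (shuffle_sign (length vs) A * (-1) ^ (s * ?l)) *\<^sub>C
           hom_part (fst a) (fst b) x s ?f ?v) =
      (shuffle_sign (length vs) A * (-1) ^ ((m + card A) * ?l)) *\<^sub>C ?f ?v"
    by (cases "even (m + card A)") (auto simp: part sum_over_parity uminus_power_if)
qed

text \<open>Every summand of the composition has bundle degree \<open>m + n + |vs|\<close>, as \<open>|A|\<close> and the size of its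
  complement add up to \<open>|vs|\<close>.\<close>

lemma supertrace_df_comp:
  assumes a: "graded_holomorphic_bundle M (fst a)" and b: "graded_holomorphic_bundle M (fst b)"
    and \<alpha>: "\<alpha> \<in> Hom_DFc M a b" "has_total_degree M a b \<alpha> m"
    and \<beta>: "has_total_degree M b a \<beta> n"
    and x: "x \<in> pts M" and vs: "vs \<in> lists (tangent_space M x)"
  shows "supertrace (fst b) x (df_comp a b \<alpha> \<beta> x vs) =
     (if even (m + n + length vs) then
        \<Sum>A\<in>Pow {..<length vs}.
          (shuffle_sign (length vs) A * (-1) ^ ((m + card A) * card ({..<length vs} - A))) *
          graded_trace (fst b) x
            (\<lambda>u. \<alpha> x (nths vs A) (\<beta> x (nths vs ({..<length vs} - A)) u))
      else 0)"
proof -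
  let ?I = "Pow {..<length vs}" and ?d = "m + n + length vs"
  define c where "c A = shuffle_sign (length vs) A *
    (-1) ^ ((m + card A) * card ({..<length vs} - A))" for A
  define h where "h A u = \<alpha> x (nths vs A) (\<beta> x (nths vs ({..<length vs} - A)) u)" for A u
  have comp: "df_comp a b \<alpha> \<beta> x vs u = (\<Sum>A\<in>?I. c A *\<^sub>C h A u)"
    if "u \<in> vb_fibre (gpart (fst b) i) x" for u i
    using df_comp_homogeneous[OF a b \<alpha> \<beta> x vs that] by (simp add: c_def h_def)
  have deg: "hom_degree (fst b) (fst b) x ?d (h A)" if "A \<in> ?I" for A
    unfolding hom_degree_def
  proof (intro allI image_subsetI)
    fix i u assume u: "u \<in> vb_fibre (gpart (fst b) i) x"
    let ?l = "card ({..<length vs} - A)"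
    have A: "A \<subseteq> {..<length vs}" using that by auto
    have "card A + ?l = length vs"
      using A card_mono[OF _ A] by (simp add: card_Diff_subset finite_subset)
    then have "i + ?d = i + (n + ?l) + (m + card A)" by simp
    moreover have "\<beta> x (nths vs ({..<length vs} - A)) u \<in> vb_fibre (gpart (fst a) (i + (n + ?l))) x"
      by (rule hom_degreeD[OF hom_form_degree[OF \<beta> x vs] u]) auto
    ultimately show "h A u \<in> vb_fibre (gpart (fst b) (i + ?d)) x"
      using hom_degreeD[OF hom_form_degree[OF \<alpha>(2) x vs A]] by (simp only: h_def)
  qed
  have "hom_degree (fst b) (fst b) x ?d (df_comp a b \<alpha> \<beta> x vs)"
    unfolding hom_degree_def
  proof (intro allI image_subsetI)
    fix i u assume u: "u \<in> vb_fibre (gpart (fst b) i) x"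
    show "df_comp a b \<alpha> \<beta> x vs u \<in> vb_fibre (gpart (fst b) (i + ?d)) x"
      unfolding comp[OF u]
      by (intro complex_vector.subspace_sum complex_vector.subspace_scale subspace_gpart[OF b x]
          hom_degreeD[OF deg u])
  qed
  then have "supertrace (fst b) x (df_comp a b \<alpha> \<beta> x vs) =
      (if even ?d then graded_trace (fst b) x (df_comp a b \<alpha> \<beta> x vs) else 0)"
    by (rule supertrace_homogeneous[OF b x])
  also have "graded_trace (fst b) x (df_comp a b \<alpha> \<beta> x vs) =
      graded_trace (fst b) x (\<lambda>u. \<Sum>A\<in>?I. c A *\<^sub>C h A u)"
    unfolding graded_trace_def
    by (intro sum.cong refl arg_cong2[of _ _ _ _ "(*)"] ctrace_cong finite_dimensional_gpart[OF b x])
      (rule comp)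
  finally have str: "supertrace (fst b) x (df_comp a b \<alpha> \<beta> x vs) =
      (if even ?d then graded_trace (fst b) x (\<lambda>u. \<Sum>A\<in>?I. c A *\<^sub>C h A u) else 0)" .
  have "graded_trace (fst b) x (\<lambda>u. \<Sum>A\<in>?I. c A *\<^sub>C h A u) =
      (\<Sum>A\<in>?I. c A * graded_trace (fst b) x (h A))" if "even ?d"
    by (rule graded_trace_sum[OF b x deg that])
  then have "supertrace (fst b) x (df_comp a b \<alpha> \<beta> x vs) =
      (if even ?d then \<Sum>A\<in>?I. c A * graded_trace (fst b) x (h A) else 0)"
    unfolding str by (cases "even ?d") simp_all
  then show ?thesis unfolding c_def h_def .
qed

text \<open>Modulo 2, the exponents on both sides add up to \<open>mn + kn + kl\<close>.\<close>

lemma sign_exchange: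
  "(-1 :: complex) ^ (k * l) * (-1) ^ ((m + k) * l) * (-1) ^ ((m + k) * (n + l)) =
     (-1) ^ (m * n) * (-1) ^ ((n + l) * k)"
  by (cases "even k"; cases "even l"; cases "even m"; cases "even n") (simp_all add: uminus_power_if)

text \<open>The summand for \<open>A\<close> on the left corresponds to the summand for the complement of \<open>A\<close> on the
  right, where \<open>\<alpha>\<close> and \<open>\<beta>\<close> receive the same arguments.\<close>

lemma supertrace_df_comp_commute:
  assumes a: "graded_holomorphic_bundle M (fst a)" and b: "graded_holomorphic_bundle M (fst b)"
    and \<alpha>: "\<alpha> \<in> Hom_DFc M a b" "has_total_degree M a b \<alpha> m"
    and \<beta>: "\<beta> \<in> Hom_DFc M b a" "has_total_degree M b a \<beta> n"
    and x: "x \<in> pts M" and vs: "vs \<in> lists (tangent_space M x)"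
  shows "supertrace (fst b) x (df_comp a b \<alpha> \<beta> x vs) =
     (-1) ^ (m * n) * supertrace (fst a) x (df_comp b a \<beta> \<alpha> x vs)"
proof (cases "even (m + n + length vs)")
  case False
  then have "\<not> even (n + m + length vs)" by (metis add.commute)
  with False show ?thesis
    by (simp only: supertrace_df_comp[OF a b \<alpha> \<beta>(2) x vs] supertrace_df_comp[OF b a \<beta> \<alpha>(2) x vs]
        if_False mult_zero_right)
next
  case True
  let ?N = "length vs"
  let ?C = "\<lambda>A. {..<?N} - A"
  define G where "G A = graded_trace (fst a) x (\<lambda>u. \<beta> x (nths vs (?C A)) (\<alpha> x (nths vs A) u))" for A
  have "supertrace (fst b) x (df_comp a b \<alpha> \<beta> x vs) =
      (\<Sum>A\<in>Pow {..<?N}. (shuffle_sign ?N A * (-1) ^ ((m + card A) * card (?C A))) *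
        graded_trace (fst b) x (\<lambda>u. \<alpha> x (nths vs A) (\<beta> x (nths vs (?C A)) u)))"
    using supertrace_df_comp[OF a b \<alpha> \<beta>(2) x vs] True by simp
  also have "\<dots> = (\<Sum>A\<in>Pow {..<?N}. (-1) ^ (m * n) *
      (shuffle_sign ?N (?C A) * (-1) ^ ((n + card (?C A)) * card A) * G A))"
  proof (rule sum.cong[OF refl])
    fix A assume "A \<in> Pow {..<?N}"
    then have A: "A \<subseteq> {..<?N}" by auto
    let ?k = "card A" and ?l = "card (?C A)"
    have "?k + ?l = ?N"
      using A card_mono[OF _ A] by (simp add: card_Diff_subset finite_subset)
    then have "even ((m + ?k) + (n + ?l))" using True by (metis add.assoc add.left_commute)
    then have tr: "graded_trace (fst b) x (\<lambda>u. \<alpha> x (nths vs A) (\<beta> x (nths vs (?C A)) u)) =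
        (-1) ^ ((m + ?k) * (n + ?l)) * G A"
      unfolding G_def
      by (intro graded_trace_commute[OF a b x] smooth_hom_form_linear[OF \<alpha>(1) x]
          smooth_hom_form_linear[OF \<beta>(1) x] hom_form_degree[OF \<alpha>(2) x vs A]
          hom_form_degree[OF \<beta>(2) x vs] nths_in_lists[OF vs]) auto
    \<comment> \<open>Shuffle signs square to 1, so the product formula can be solved for one factor.\<close>
    have sq: "shuffle_sign ?N (?C A) * shuffle_sign ?N (?C A) = 1"
      by (simp add: shuffle_sign_def flip: power_mult_distrib)
    have "shuffle_sign ?N A =
        shuffle_sign ?N A * (shuffle_sign ?N (?C A) * shuffle_sign ?N (?C A))"
      by (simp add: sq)
    also have "\<dots> = shuffle_sign ?N (?C A) * (-1) ^ (?k * ?l)"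
      using shuffle_sign_complement[OF A] by (simp add: mult_ac)
    finally have sh: "shuffle_sign ?N A = shuffle_sign ?N (?C A) * (-1) ^ (?k * ?l)" .
    have "(shuffle_sign ?N A * (-1) ^ ((m + ?k) * ?l)) *
        graded_trace (fst b) x (\<lambda>u. \<alpha> x (nths vs A) (\<beta> x (nths vs (?C A)) u)) =
        ((-1) ^ (?k * ?l) * (-1) ^ ((m + ?k) * ?l) * (-1) ^ ((m + ?k) * (n + ?l))) *
          (shuffle_sign ?N (?C A) * G A)"
      unfolding tr sh by (simp only: mult_ac)
    also have "\<dots> = (-1) ^ (m * n) * (-1) ^ ((n + ?l) * ?k) * (shuffle_sign ?N (?C A) * G A)"
      by (simp only: sign_exchange)
    finally show "(shuffle_sign ?N A * (-1) ^ ((m + ?k) * ?l)) *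
        graded_trace (fst b) x (\<lambda>u. \<alpha> x (nths vs A) (\<beta> x (nths vs (?C A)) u)) =
        (-1) ^ (m * n) * (shuffle_sign ?N (?C A) * (-1) ^ ((n + ?l) * ?k) * G A)"
      by (simp only: mult_ac)
  qed
  also have "\<dots> = (-1) ^ (m * n) * (\<Sum>A\<in>Pow {..<?N}.
      shuffle_sign ?N (?C A) * (-1) ^ ((n + card (?C A)) * card A) * G A)"
    by (rule sum_distrib_left[symmetric])
  also have "(\<Sum>A\<in>Pow {..<?N}.
      shuffle_sign ?N (?C A) * (-1) ^ ((n + card (?C A)) * card A) * G A) =
    (\<Sum>B\<in>Pow {..<?N}. shuffle_sign ?N B * (-1) ^ ((n + card B) * card (?C B)) *
      graded_trace (fst a) x (\<lambda>u. \<beta> x (nths vs B) (\<alpha> x (nths vs (?C B)) u)))"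
    by (rule sum.reindex_bij_witness[of _ ?C ?C]) (auto simp: G_def double_diff)
  also have "\<dots> = supertrace (fst a) x (df_comp b a \<beta> \<alpha> x vs)"
    unfolding supertrace_df_comp[OF b a \<beta> \<alpha>(2) x vs] using True
    by (metis (no_types, lifting) add.commute)
  finally show ?thesis .
qed


section \<open>Coordinate vectors are tangent vectors\<close>

lemma chart_homeomorphism:
  assumes "complex_manifold M" "c \<in> cm_charts M"
  shows "openin (cm_top M) (fst c)" "open (snd c ` fst c)"
    "homeomorphic_map (subtopology (cm_top M) (fst c)) (top_of_set (snd c ` fst c)) (snd c)"
proof -
  have "\<forall>(U, \<phi>)\<in>cm_charts M. openin (cm_top M) U \<and> open (\<phi> ` U) \<and>
      homeomorphic_map (subtopology (cm_top M) U) (top_of_set (\<phi> ` U)) \<phi>"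
    using assms(1) by (simp add: complex_manifold_def)
  from bspec[OF this assms(2)] show "openin (cm_top M) (fst c)" "open (snd c ` fst c)"
    "homeomorphic_map (subtopology (cm_top M) (fst c)) (top_of_set (snd c ` fst c)) (snd c)"
    by (simp_all add: case_prod_unfold)
qed

lemma chart_inv_chart:
  assumes M: "complex_manifold M" and c: "c \<in> cm_charts M" and y: "y \<in> fst c"
  shows "chart_inv c (snd c y) = y"
proof -
  have "inj_on (snd c) (fst c)"
    using chart_homeomorphism[OF M c] homeomorphic_imp_injective_map openin_subset
      topspace_subtopology_subset by metis
  then show ?thesis using y by (simp add: chart_inv_def)
qed

lemma open_chart_image:
  assumes M: "complex_manifold M" and c: "c \<in> cm_charts M" and V: "openin (cm_top M) V"
  shows "open (snd c ` (fst c \<inter> V))"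
proof -
  note U = chart_homeomorphism[OF M c]
  have "openin (subtopology (cm_top M) (fst c)) (fst c \<inter> V)"
    using V by (simp add: openin_subtopology_Int2)
  then have "openin (top_of_set (snd c ` fst c)) (snd c ` (fst c \<inter> V))"
    using homeomorphic_imp_open_map[OF U(3)] by (simp add: open_map_def)
  then show ?thesis using U(2) openin_open_trans by blast
qed

text \<open>Coordinate changes are holomorphic componentwise; differentiability of the vector-valued map is
  tested against the real basis vectors of coordinate space.\<close>

lemma differentiable_transition:
  assumes M: "complex_manifold M" and c: "c \<in> charts_at M x" and c': "c' \<in> charts_at M x"
  shows "(snd c' \<circ> chart_inv c) differentiable (at (snd c x))"
proof -
  have "(\<lambda>z. snd c' (chart_inv c z) $ k) differentiable (at (snd c x))" for k
  proof -
    have "holo_on (snd c ` (fst c \<inter> fst c')) (\<lambda>z. snd c' (chart_inv c z) $ k)"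
      using M c c' unfolding complex_manifold_def charts_at_def by blast
    moreover have "snd c x \<in> snd c ` (fst c \<inter> fst c')" using c c' by (auto simp: charts_at_def)
    ultimately show ?thesis unfolding holo_on_def differentiable_def by blast
  qed
  note component = this
  have "(\<lambda>z. (snd c' \<circ> chart_inv c) z \<bullet> i) differentiable (at (snd c x))"
    if "i \<in> Basis" for i
  proof -
    obtain k b where "i = axis k b" using \<open>i \<in> Basis\<close> unfolding Basis_vec_def by blast
    then have "(\<lambda>z. (snd c' \<circ> chart_inv c) z \<bullet> i) = (\<lambda>z. snd c' (chart_inv c z) $ k \<bullet> b)"
      by (simp add: inner_axis)
    then show ?thesis using component by (simp add: differentiable_inner)
  qed
  then show ?thesis using differentiable_componentwise_within[of _ _ UNIV] by blast
qed

text \<open>The chain rule for the composition of two coordinate changes. The composite agrees with the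
  direct coordinate change only near the point, on the open image of the overlap of the charts
  \<open>c\<close> and \<open>c'\<close>.\<close>

lemma jacobian_chain:
  assumes M: "complex_manifold M" and c: "c \<in> charts_at M x" and c': "c' \<in> charts_at M x"
    and c'': "c'' \<in> charts_at M x"
  shows "jacobian c' c'' x (jacobian c c' x w) = jacobian c c'' x w"
proof -
  let ?f = "snd c' \<circ> chart_inv c" and ?g = "snd c'' \<circ> chart_inv c'"
  let ?S = "snd c ` (fst c \<inter> fst c')"
  have mem: "c \<in> cm_charts M" "c' \<in> cm_charts M" "x \<in> fst c" "x \<in> fst c'"
    using c c' by (auto simp: charts_at_def)
  have fx: "?f (snd c x) = snd c' x" using chart_inv_chart[OF M] mem by simp
  have f: "(?f has_derivative jacobian c c' x) (at (snd c x))"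
    using differentiable_transition[OF M c c'] by (simp add: jacobian_def frechet_derivative_works)
  have g: "(?g has_derivative jacobian c' c'' x) (at (?f (snd c x)))"
    using differentiable_transition[OF M c' c''] unfolding fx
    by (simp add: jacobian_def frechet_derivative_works)
  have "((?g \<circ> ?f) has_derivative (jacobian c' c'' x \<circ> jacobian c c' x)) (at (snd c x))"
    by (rule diff_chain_at[OF f g])
  then have "((snd c'' \<circ> chart_inv c) has_derivative (jacobian c' c'' x \<circ> jacobian c c' x))
      (at (snd c x))"
  proof (rule has_derivative_transform_within_open)
    show "open ?S" using open_chart_image[OF M mem(1) chart_homeomorphism(1)[OF M mem(2)]] .
    show "snd c x \<in> ?S" using mem by auto
    show "(?g \<circ> ?f) z = (snd c'' \<circ> chart_inv c) z" if z: "z \<in> ?S" for z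
    proof -
      obtain y where "z = snd c y" "y \<in> fst c" "y \<in> fst c'" using z by blast
      then show ?thesis using chart_inv_chart[OF M] mem by simp
    qed
  qed
  from frechet_derivative_at[OF this]
  have "jacobian c' c'' x \<circ> jacobian c c' x = jacobian c c'' x"
    by (simp only: jacobian_def[of c c''])
  then show ?thesis by (metis comp_apply)
qed

lemma coord_vec_tangent:
  assumes "complex_manifold M" "c \<in> charts_at M x"
  shows "coord_vec M c x w \<in> tangent_space M x"
  using jacobian_chain[OF assms] by (auto simp: tangent_space_def coord_vec_def)


section \<open>Integration\<close>

text \<open>The integral evaluates a form only at points of the manifold and on coordinate vectors, so an
  identity on tangent vectors suffices. Pulling out a scalar is valid for divergent sums and
  integrals as well, since these are 0 by convention.\<close>

lemma form_integral_cong_scaled: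
  assumes M: "complex_manifold M"
    and eq: "\<And>x vs. x \<in> pts M \<Longrightarrow> vs \<in> lists (tangent_space M x) \<Longrightarrow> \<omega> x vs = k * \<eta> x vs"
  shows "form_integral M \<omega> = k * form_integral M \<eta>"
proof -
  define \<rho> where "\<rho> = (SOME \<rho>. partition_of_unity M \<rho>)"
  have "(LINT z : snd c ` fst c | lborel. \<rho> c (chart_inv c z) *\<^sub>R
           \<omega> (chart_inv c z) (map (coord_vec M c (chart_inv c z)) oriented_basis)) =
      k * (LINT z : snd c ` fst c | lborel. \<rho> c (chart_inv c z) *\<^sub>R
           \<eta> (chart_inv c z) (map (coord_vec M c (chart_inv c z)) oriented_basis))"
    if c: "c \<in> cm_charts M" for c
  proof -
    have "\<omega> (chart_inv c z) (map (coord_vec M c (chart_inv c z)) oriented_basis) =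
        k * \<eta> (chart_inv c z) (map (coord_vec M c (chart_inv c z)) oriented_basis)"
      if "z \<in> snd c ` fst c" for z
    proof (rule eq)
      have U: "chart_inv c z \<in> fst c" using that chart_inv_chart[OF M c] by auto
      then show "chart_inv c z \<in> pts M"
        using chart_homeomorphism(1)[OF M c] openin_subset by blast
      show "map (coord_vec M c (chart_inv c z)) oriented_basis \<in> lists (tangent_space M (chart_inv c z))"
        using U c by (auto intro!: coord_vec_tangent[OF M] simp: charts_at_def)
    qed
    then show ?thesis
      unfolding set_lebesgue_integral_def integral_mult_right_zero[symmetric]
      by (intro Bochner_Integration.integral_cong) (auto simp: indicator_def)
  qed
  then show ?thesis
    unfolding form_integral_def Let_def \<rho>_def[symmetric] infsum_cmult_right'[symmetric]
    by (intro infsum_cong) auto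
qed


theorem proposition6p2:
  fixes M :: "('x, 'd::finite) cmfd"
    and W :: "'x \<Rightarrow> complex"
    and \<Omega> :: "('x, 'd) cform"
    and a\<^sub>1 :: "('x, 'e1::complex_vector) factorization"
    and a\<^sub>2 :: "('x, 'e2::complex_vector) factorization"
    and \<alpha> :: "('x, 'd, 'e1, 'e2) hom_form"
    and \<beta> :: "('x, 'd, 'e2, 'e1) hom_form"
    and m n :: nat
  assumes "landau_ginzburg_pair M W"
    and "holomorphic_volume_form M \<Omega>"
    and "holomorphic_factorization M W a\<^sub>1"
    and "holomorphic_factorization M W a\<^sub>2"
    and "\<alpha> \<in> Hom_DFc M a\<^sub>1 a\<^sub>2"
    and "\<beta> \<in> Hom_DFc M a\<^sub>2 a\<^sub>1"
    and "has_total_degree M a\<^sub>1 a\<^sub>2 \<alpha> m"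
    and "has_total_degree M a\<^sub>2 a\<^sub>1 \<beta> n"
  shows "trB M \<Omega> a\<^sub>2 (df_comp a\<^sub>1 a\<^sub>2 \<alpha> \<beta>) =
         (-1) ^ (m * n) * trB M \<Omega> a\<^sub>1 (df_comp a\<^sub>2 a\<^sub>1 \<beta> \<alpha>)"
proof -
  have M: "complex_manifold M"
    using assms(1) by (simp add: landau_ginzburg_pair_def)
  have E: "graded_holomorphic_bundle M (fst a\<^sub>1)" "graded_holomorphic_bundle M (fst a\<^sub>2)"
    using assms(3,4) by (auto simp: holomorphic_factorization_def split: prod.splits)
  let ?\<alpha>\<beta> = "ext_supertrace (fst a\<^sub>2) (df_comp a\<^sub>1 a\<^sub>2 \<alpha> \<beta>)"
  let ?\<beta>\<alpha> = "ext_supertrace (fst a\<^sub>1) (df_comp a\<^sub>2 a\<^sub>1 \<beta> \<alpha>)"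
  show ?thesis
    unfolding trB_def
  proof (rule form_integral_cong_scaled[OF M])
    fix x vs assume x: "x \<in> pts M" and vs: "vs \<in> lists (tangent_space M x)"
    have "?\<alpha>\<beta> x (nths vs A) = (-1) ^ (m * n) * ?\<beta>\<alpha> x (nths vs A)" for A
      unfolding ext_supertrace_def
      by (rule supertrace_df_comp_commute[OF E assms(5,7,6,8) x nths_in_lists[OF vs]])
    then show "wedge \<Omega> ?\<alpha>\<beta> x vs = (-1) ^ (m * n) * wedge \<Omega> ?\<beta>\<alpha> x vs"
      by (simp add: wedge_def sum_distrib_left mult_ac)
  qed
qed

end
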